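(* Let $r\geq 3$ be an integer, let $n\ge 2$ be an integer, and let $\alpha$ be a real number with $(\ln n)^{-1/(r-1)}\leq\alpha\leq r^{-3}$. Then every $r$-uniform graph with $n$ vertices and at least $\alpha n^{r}/r!$ edges contains (as a subgraph) a $K_{r}(s,\ldots,s,t)$, with $r-1$ parts of size $s$ and one part of size $t$, where $s=\left\lfloor \alpha(\ln n)^{1/(r-1)}\right\rfloor$ and $t=\left\lceil n^{1-\alpha^{r-2}}\right\rceil$.
   Context: An $r$-uniform graph (hypergraph) consists of a finite vertex set together with a set of edges, each edge being a subset of exactly $r$ distinct vertices. $K_{r}(s_{1},\ldots,s_{r})$ denotes the complete $r$-partite $r$-uniform graph with parts of sizes $s_{1},\ldots,s_{r}$: its vertex set is the disjoint union of sets $V_1,\dots,V_r$ with $|V_i|=s_i$, and its edges are all $r$-sets containing exactly one vertex from each $V_i$. "Contains" means as a (not necessarily induced) subgraph. $\ln$ is the natural logarithm. *)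

theory Defs
  imports Complex_Main
begin

type_synonym 'a hypergraph = "'a set \<times> 'a set set"

abbreviation verts :: "'a hypergraph \<Rightarrow> 'a set" where
  "verts \<equiv> fst"

abbreviation edges :: "'a hypergraph \<Rightarrow> 'a set set" where
  "edges \<equiv> snd"

definition uniform_graph :: "nat \<Rightarrow> 'a hypergraph \<Rightarrow> bool" where
  "uniform_graph r G \<longleftrightarrow>
     finite (verts G) \<and> (\<forall>e\<in>edges G. e \<subseteq> verts G \<and> card e = r)"

text \<open>Tagging the vertices with the index \<open>i < r\<close> of their part makes the parts disjoint.\<close>

definition part :: "(nat \<Rightarrow> nat) \<Rightarrow> nat \<Rightarrow> (nat \<times> nat) set" where
  "part s i = {i} \<times> {..<s i}"

definition complete_partite :: "nat \<Rightarrow> (nat \<Rightarrow> nat) \<Rightarrow> (nat \<times> nat) hypergraph" where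
  "complete_partite r s =
     (let V = (\<Union>i<r. part s i)
      in (V, {e. e \<subseteq> V \<and> card e = r \<and> (\<forall>i<r. card (e \<inter> part s i) = 1)}))"

definition contains_copy :: "'a hypergraph \<Rightarrow> 'b hypergraph \<Rightarrow> bool" where
  "contains_copy G H \<longleftrightarrow>
     (\<exists>f. inj_on f (verts H) \<and> f ` verts H \<subseteq> verts G \<and>
          (\<forall>e\<in>edges H. f ` e \<in> edges G))"

end

(* Idea: the ordered edges are a set of r-tuples of density at least alpha in V^r. Replacing one of
   the first k = r - 1 coordinates by an s-tuple all of whose entries must fit raises the density
   to at least its s-th power, by the power mean inequality. After k steps, a proportion at least
   alpha^(s^k) of all choices of k s-tuples and a vertex are copies of K_r(s,...,s,1), degenerate
   ones included. At most k s^2 n^(ks) of the n^(ks+1) choices involve a repetition inside an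
   s-tuple, so some k repetition-free s-tuples have at least n alpha^(s^k) - k s^2 common
   neighbours. Vertices in different parts differ automatically, since an edge has r distinct
   vertices. Finally s^k <= alpha^k ln n and ln (1/alpha) <= 1/(2 alpha) give
   n alpha^(s^k) >= n^(1 - alpha^(k-1)/2), and alpha^(k-1) ln n >= 27 leaves room for the
   subtracted term. *)

theory Submission
  imports Defs "HOL-Analysis.Convex" "HOL-Combinatorics.Multiset_Permutations"
begin

section \<open>Tuples over a finite set and the power mean inequality\<close>

definition tuples :: "nat \<Rightarrow> 'a set \<Rightarrow> 'a list set" where
  "tuples k X = {xs. set xs \<subseteq> X \<and> length xs = k}"

lemma finite_tuples: "finite X \<Longrightarrow> finite (tuples k X)"
  unfolding tuples_def by (rule finite_lists_length_eq)

lemma card_tuples: "finite X \<Longrightarrow> card (tuples k X) = card X ^ k"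
  unfolding tuples_def by (rule card_lists_length_eq)

lemma tuples_0: "tuples 0 X = {[]}"
  unfolding tuples_def by auto

lemma sum_tuples_Suc:
  "(\<Sum>xs\<in>tuples (Suc k) X. f xs) = (\<Sum>x\<in>X. \<Sum>xs\<in>tuples k X. f (x # xs))"
proof -
  have "bij_betw (\<lambda>(x, xs). x # xs) (X \<times> tuples k X) (tuples (Suc k) X)"
    by (rule bij_betw_byWitness[where f' = "\<lambda>xs. (hd xs, tl xs)"])
       (auto simp: tuples_def length_Suc_conv)
  then have "(\<Sum>xs\<in>tuples (Suc k) X. f xs) = (\<Sum>(x, xs)\<in>X \<times> tuples k X. f (x # xs))"
    by (subst sum.reindex_bij_betw[symmetric]) (auto simp: case_prod_unfold)
  then show ?thesis by (simp add: sum.cartesian_product)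
qed

lemma real_card_filter_eq_sum:
  "finite X \<Longrightarrow> real (card {x \<in> X. P x}) = (\<Sum>x\<in>X. of_bool (P x))"
  by (simp add: Int_def)

text \<open>Jensen's inequality for the map sending x to x^s, with uniform weights on
  \<open>Z\<close>; \<open>p\<close> is a lower bound for the average of \<open>d\<close>.\<close>

lemma power_mean_sum:
  fixes d :: "'z \<Rightarrow> real" and p :: real
  assumes "finite Z" "Z \<noteq> {}" "\<And>z. z \<in> Z \<Longrightarrow> 0 \<le> d z" "0 \<le> p"
    and "p * card Z \<le> (\<Sum>z\<in>Z. d z)"
  shows "p ^ s * card Z \<le> (\<Sum>z\<in>Z. d z ^ s)"
proof -
  have c0: "card Z > 0" using assms by (simp add: card_gt_0_iff)
  \<comment> \<open>Odd powers are convex only on the nonnegative half-line, so the parities are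
    treated separately.\<close>
  have cv: "convex_on {0..} (\<lambda>x::real. x ^ s)"
    using convex_power_even[of s] convex_power_odd[of s] convex_on_subset[of UNIV _ "{0..}"]
    by (cases "even s") auto
  have "(\<Sum>z\<in>Z. (1 / card Z) *\<^sub>R d z) ^ s \<le> (\<Sum>z\<in>Z. (1 / card Z) * d z ^ s)"
    by (rule convex_on_sum[OF assms(1,2) cv]) (use assms c0 in auto)
  moreover have "p \<le> (\<Sum>z\<in>Z. (1 / card Z) *\<^sub>R d z)"
    using assms(5) c0 by (simp add: sum_divide_distrib[symmetric] field_simps)
  ultimately have "p ^ s \<le> (\<Sum>z\<in>Z. d z ^ s) / card Z"
    using power_mono[OF _ assms(4), of _ s] by (fastforce simp: sum_divide_distrib)
  then show ?thesis using c0 by (simp add: field_simps)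
qed

section \<open>Blowing up coordinates to tuples\<close>

text \<open>For an edge predicate \<open>P\<close>, this says that the lists in \<open>A\<close>
  span a complete partite graph, possibly a degenerate one, since entries may repeat.
  \<open>list_all2\<close> lets the first list be peeled off, as the induction on the number of
  parts requires.\<close>

definition choice_all :: "('a list \<Rightarrow> bool) \<Rightarrow> 'a list list \<Rightarrow> bool" where
  "choice_all P A \<longleftrightarrow> (\<forall>xs. list_all2 (\<lambda>x a. x \<in> set a) xs A \<longrightarrow> P xs)"

lemma choice_all_Nil: "choice_all P [] = P []"
  by (simp add: choice_all_def)

lemma choice_all_Cons: "choice_all P (a # A) \<longleftrightarrow> (\<forall>x\<in>set a. choice_all (\<lambda>xs. P (x # xs)) A)"
  by (auto simp: choice_all_def list_all2_Cons2)

text \<open>The tuples counted are exactly those over the set of good elements. This turns an s-th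
  power of a degree into a count of s-tuples.\<close>

lemma sum_tuples_of_bool_ball:
  assumes "finite X"
  shows "(\<Sum>a\<in>tuples s X. of_bool (\<forall>x\<in>set a. Q x)) = (\<Sum>x\<in>X. of_bool (Q x) :: real) ^ s"
proof -
  have "{a \<in> tuples s X. \<forall>x\<in>set a. Q x} = tuples s {x \<in> X. Q x}"
    by (auto simp: tuples_def)
  then show ?thesis
    using assms card_tuples[of "{x \<in> X. Q x}" s]
    by (simp only: real_card_filter_eq_sum[symmetric] finite_tuples) simp
qed

text \<open>The extra parameter \<open>y\<close> collects the coordinates that have not been blown up; it is a list
  only so that the induction can move a coordinate into it without changing its type.\<close>

lemma blow_up_density:
  fixes V :: "'a set" and p :: real and P :: "'a list \<Rightarrow> 'a list \<Rightarrow> bool"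
  assumes "finite V" "V \<noteq> {}" "finite Y" "Y \<noteq> {}" "0 \<le> p"
    and "p * real (card V) ^ k * card Y
      \<le> (\<Sum>y\<in>Y. \<Sum>xs\<in>tuples k V. of_bool (P xs y))"
  shows "p ^ (s ^ k) * real (card (tuples s V)) ^ k * card Y
      \<le> (\<Sum>y\<in>Y. \<Sum>A\<in>tuples k (tuples s V). of_bool (choice_all (\<lambda>xs. P xs y) A))"
  using assms(3-)
proof (induction k arbitrary: P Y)
  case 0
  then show ?case by (simp add: tuples_0 choice_all_Nil del: sum_of_bool_eq)
next
  case (Suc k)
  let ?L = "tuples s V" and ?B = "tuples k (tuples s V)"
  let ?Q = "\<lambda>x A y. choice_all (\<lambda>xs. P (x # xs) y) A"
  \<comment> \<open>The first coordinate moves into the parameter, so the induction hypothesis blows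
    up the other \<open>k\<close> coordinates; \<open>hd\<close> and \<open>tl\<close> recover the
    two components.\<close>
  let ?Y' = "(\<lambda>(x, y). x # y) ` (V \<times> Y)"
  have inj: "inj_on (\<lambda>(x, y). x # y) (V \<times> Y)" by (auto simp: inj_on_def)
  have sumY': "(\<Sum>z\<in>?Y'. g z) = (\<Sum>x\<in>V. \<Sum>y\<in>Y. g (x # y))" for g :: "'a list \<Rightarrow> real"
    by (subst sum.reindex[OF inj]) (simp add: sum.cartesian_product case_prod_unfold)
  have cY': "card ?Y' = card V * card Y"
    using card_image[OF inj] by (simp add: card_cartesian_product)
  have finL: "finite ?L" "finite ?B" using assms(1) by (auto intro: finite_tuples)
  have cardL: "card ?L = card V ^ s" using assms(1) by (rule card_tuples)
  have cV: "card V > 0" using assms by (simp add: card_gt_0_iff)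
  have cB: "card ?B = card ?L ^ k" using finL by (simp add: card_tuples)
  have B_ne: "?B \<noteq> {}"
    using cB cardL cV by (metis card.empty not_gr_zero power_eq_0_iff)
  have "p * real (card V) ^ k * card ?Y'
      \<le> (\<Sum>z\<in>?Y'. \<Sum>xs\<in>tuples k V. of_bool (P (hd z # xs) (tl z)))"
    using Suc.prems(4)
    by (simp add: sumY' cY' sum_tuples_Suc sum.swap[of _ V Y] mult_ac)
  then have IH: "p ^ (s ^ k) * real (card ?L) ^ k * card ?Y'
      \<le> (\<Sum>z\<in>?Y'. \<Sum>A\<in>?B. of_bool (choice_all (\<lambda>xs. P (hd z # xs) (tl z)) A))"
    by (intro Suc.IH) (use Suc.prems assms in auto)
  \<comment> \<open>\<open>?d\<close> counts the vertices \<open>x\<close> that extend the pair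
    (\<open>A\<close>, \<open>y\<close>). Swapping sums turns the induction hypothesis into a lower
    bound for its average.\<close>
  let ?d = "\<lambda>(A, y). (\<Sum>x\<in>V. of_bool (?Q x A y)) :: real"
  have "(\<Sum>z\<in>?Y'. \<Sum>A\<in>?B. of_bool (choice_all (\<lambda>xs. P (hd z # xs) (tl z)) A))
      = (\<Sum>x\<in>V. \<Sum>y\<in>Y. \<Sum>A\<in>?B. of_bool (?Q x A y) :: real)"
    by (simp add: sumY')
  also have "\<dots> = (\<Sum>y\<in>Y. \<Sum>x\<in>V. \<Sum>A\<in>?B. of_bool (?Q x A y))"
    by (rule sum.swap)
  also have "\<dots> = (\<Sum>y\<in>Y. \<Sum>A\<in>?B. \<Sum>x\<in>V. of_bool (?Q x A y))"
    by (intro sum.cong refl sum.swap)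
  also have "\<dots> = (\<Sum>A\<in>?B. \<Sum>y\<in>Y. \<Sum>x\<in>V. of_bool (?Q x A y))"
    by (rule sum.swap)
  also have "\<dots> = (\<Sum>z\<in>?B \<times> Y. ?d z)"
    by (rule sum.cartesian_product)
  finally have "(p ^ (s ^ k) * card V) * card (?B \<times> Y) \<le> (\<Sum>z\<in>?B \<times> Y. ?d z)"
    using IH by (simp add: cY' cB card_cartesian_product mult_ac)
  \<comment> \<open>Raising to the power \<open>s\<close> turns the exponent s^k into s^(k+1), and
    the s-th power of \<open>?d\<close> counts the lists \<open>a\<close> all of whose entries
    extend (\<open>A\<close>, \<open>y\<close>).\<close>
  then have "(p ^ (s ^ k) * card V) ^ s * card (?B \<times> Y) \<le> (\<Sum>z\<in>?B \<times> Y. ?d z ^ s)"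
    using Suc.prems finL B_ne by (intro power_mean_sum) (auto intro!: sum_nonneg)
  also have "(\<Sum>z\<in>?B \<times> Y. ?d z ^ s)
      = (\<Sum>A\<in>?B. \<Sum>y\<in>Y. \<Sum>a\<in>?L. of_bool (choice_all (\<lambda>xs. P xs y) (a # A)))"
    unfolding choice_all_Cons sum_tuples_of_bool_ball[OF assms(1)]
    by (simp add: sum.cartesian_product case_prod_unfold)
  also have "\<dots> = (\<Sum>y\<in>Y. \<Sum>A\<in>?B. \<Sum>a\<in>?L. of_bool (choice_all (\<lambda>xs. P xs y) (a # A)))"
    by (rule sum.swap)
  also have "\<dots> = (\<Sum>y\<in>Y. \<Sum>a\<in>?L. \<Sum>A\<in>?B. of_bool (choice_all (\<lambda>xs. P xs y) (a # A)))"
    by (intro sum.cong refl sum.swap)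
  finally show ?case
    by (simp add: sum_tuples_Suc cB cardL card_cartesian_product power_mult_distrib
        power_mult[symmetric] mult_ac)
qed

section \<open>Discarding tuples with repetitions\<close>

text \<open>The count is a falling factorial whose \<open>s\<close> factors are all at least
  \<open>card V - s\<close>. A pure power is a form to which Bernoulli's inequality applies.\<close>

lemma card_distinct_tuples_ge:
  assumes "finite V" "s \<le> card V"
  shows "(real (card V) - s) ^ s \<le> card {a \<in> tuples s V. distinct a}"
proof -
  have "{a \<in> tuples s V. distinct a} = {a. length a = s \<and> distinct a \<and> set a \<subseteq> V}"
    by (auto simp: tuples_def)
  then have "card {a \<in> tuples s V. distinct a} = \<Prod>{card V - s + 1..card V}"
    using card_lists_distinct_length_eq[OF assms] by simp
  moreover have "(\<Prod>i\<in>{card V - s + 1..card V}. card V - s) \<le> \<Prod>{card V - s + 1..card V}"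
    by (rule prod_mono) auto
  ultimately have "(card V - s) ^ s \<le> card {a \<in> tuples s V. distinct a}"
    using assms by simp
  then show ?thesis
    using assms by (metis of_nat_diff of_nat_mono of_nat_power)
qed

text \<open>Averaging: if every repetition-free \<open>A\<close> had too few common neighbours, the
  total would fall below the bound from \<open>blow_up_density\<close>, even with all of
  \<open>V\<close> credited to each remaining choice.\<close>

lemma exists_rich_distinct_tuples:
  fixes V :: "'a set" and p :: real and P :: "'a list \<Rightarrow> 'a \<Rightarrow> bool"
  assumes "finite V" "V \<noteq> {}" "0 \<le> p" "s < card V"
    and pos: "k * real s ^ 2 < card V * p ^ (s ^ k)"
    and dens: "p * real (card V) ^ Suc k \<le> (\<Sum>v\<in>V. \<Sum>xs\<in>tuples k V. of_bool (P xs v))"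
  shows "\<exists>A \<in> tuples k {a \<in> tuples s V. distinct a}.
    card V * p ^ (s ^ k) - k * real s ^ 2 \<le> card {v \<in> V. choice_all (\<lambda>xs. P xs v) A}"
proof (rule ccontr)
  let ?L = "tuples s V" and ?n = "real (card V)"
  let ?D = "{a \<in> ?L. distinct a}" and ?N = "(real (card V) ^ s) ^ k"
  let ?d = "\<lambda>A. real (card {v \<in> V. choice_all (\<lambda>xs. P xs v) A})"
  let ?b = "?n * p ^ (s ^ k) - k * real s ^ 2"
  assume "\<not> ?thesis"
  then have less: "?d A < ?b" if "A \<in> tuples k ?D" for A using that by force
  have n0: "card V > 0" using assms by (simp add: card_gt_0_iff)
  have finL: "finite ?L" "finite (tuples k ?L)" using assms(1) by (auto intro: finite_tuples)
  have cardL: "card ?L = card V ^ s" using assms(1) by (rule card_tuples)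
  have sub: "tuples k ?D \<subseteq> tuples k ?L" by (auto simp: tuples_def)
  have cD: "card (tuples k ?D) = card ?D ^ k" using finL by (simp add: card_tuples)
  \<comment> \<open>\<open>blow_up_density\<close> takes its parameter as a list, so a vertex
    becomes a singleton.\<close>
  let ?Y = "(\<lambda>v. [v]) ` V"
  have inj: "inj_on (\<lambda>v. [v]) V" by (auto simp: inj_on_def)
  have "p ^ (s ^ k) * real (card ?L) ^ k * card ?Y
      \<le> (\<Sum>y\<in>?Y. \<Sum>A\<in>tuples k ?L. of_bool (choice_all (\<lambda>xs. P xs (hd y)) A))"
    by (rule blow_up_density)
       (use assms in \<open>auto simp: sum.reindex[OF inj] card_image[OF inj] mult_ac\<close>)
  also have "\<dots> = (\<Sum>A\<in>tuples k ?L. ?d A)"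
    using assms(1) by (simp only: real_card_filter_eq_sum)
      (subst sum.swap, simp add: sum.reindex[OF inj])
  also have "\<dots> = (\<Sum>A\<in>tuples k ?D. ?d A) + (\<Sum>A\<in>tuples k ?L - tuples k ?D. ?d A)"
    by (subst sum.subset_diff[OF sub finL(2)]) (rule add.commute)
  finally have total: "p ^ (s ^ k) * ?N * ?n
      \<le> (\<Sum>A\<in>tuples k ?D. ?d A) + (\<Sum>A\<in>tuples k ?L - tuples k ?D. ?d A)"
    by (simp add: cardL card_image[OF inj])
  have Dge: "?N * (1 - k * real s ^ 2 / ?n) \<le> card (tuples k ?D)"
  proof -
    \<comment> \<open>Bernoulli's inequality with \<open>s * k\<close> factors 1 - s/n produces the
      loss k s^2 / n.\<close>
    have "1 + real (s * k) * (- (s / ?n)) \<le> (1 + - (s / ?n)) ^ (s * k)"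
      by (rule Bernoulli_inequality) (use assms n0 in simp)
    then have "?N * (1 - k * real s ^ 2 / ?n) \<le> ?N * (1 - s / ?n) ^ (s * k)"
      by (intro mult_left_mono) (auto simp: power2_eq_square mult_ac)
    also have "\<dots> = ((?n - s) ^ s) ^ k"
      using n0 by (simp add: power_mult[symmetric] power_mult_distrib[symmetric] algebra_simps)
    also have "\<dots> \<le> real (card ?D) ^ k"
      by (intro power_mono card_distinct_tuples_ge) (use assms in auto)
    finally show ?thesis using cD by simp
  qed
  have Dle: "real (card (tuples k ?D)) \<le> ?N"
    using card_mono[OF finL(2) sub] finL cardL
    by (simp add: card_tuples) (metis of_nat_mono of_nat_power)
  have N0: "?N > 0" using n0 by simp
  \<comment> \<open>\<open>pos\<close> makes \<open>?b\<close> positive: this settles the empty sum,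
    and otherwise allows the number of terms to be rounded up to \<open>?N\<close>.\<close>
  have "(\<Sum>A\<in>tuples k ?D. ?d A) < ?N * ?b"
  proof (cases "tuples k ?D = {}")
    case True
    then show ?thesis using N0 pos by simp
  next
    case False
    then have "(\<Sum>A\<in>tuples k ?D. ?d A) < (\<Sum>A\<in>tuples k ?D. ?b)"
      using finite_subset[OF sub finL(2)] less by (intro sum_strict_mono) auto
    also have "\<dots> \<le> ?N * ?b" using Dle pos by (simp add: mult_right_mono)
    finally show ?thesis .
  qed
  moreover have "(\<Sum>A\<in>tuples k ?L - tuples k ?D. ?d A) \<le> ?N * (k * real s ^ 2)"
  proof -
    have "(\<Sum>A\<in>tuples k ?L - tuples k ?D. ?d A) \<le> (\<Sum>A\<in>tuples k ?L - tuples k ?D. ?n)"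
      using assms(1) by (intro sum_mono) (simp add: card_mono)
    also have "\<dots> = (?N - card (tuples k ?D)) * ?n"
      using finL cardL card_mono[OF finL(2) sub]
      by (simp add: card_Diff_subset[OF finite_subset[OF sub finL(2)] sub] card_tuples of_nat_diff)
    also have "\<dots> \<le> (?N * (k * real s ^ 2 / ?n)) * ?n"
      using Dge by (intro mult_right_mono) (auto simp: algebra_simps)
    also have "\<dots> = ?N * (k * real s ^ 2)" using n0 by simp
    finally show ?thesis .
  qed
  ultimately show False using total by (simp add: algebra_simps)
qed

section \<open>Ordered edges and embeddings of complete partite graphs\<close>

text \<open>Each edge has r! orderings, and different edges have disjoint sets of orderings.\<close>

lemma card_ordered_edges:
  assumes "uniform_graph r G"
  shows "card {xs \<in> tuples r (verts G). distinct xs \<and> set xs \<in> edges G} = fact r * card (edges G)"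
proof -
  have finV: "finite (verts G)" and E: "\<And>e. e \<in> edges G \<Longrightarrow> e \<subseteq> verts G \<and> card e = r"
    using assms by (auto simp: uniform_graph_def)
  have fin_e: "finite e" if "e \<in> edges G" for e using E[OF that] finV finite_subset by blast
  have finE: "finite (edges G)" using E finV by (metis Pow_iff finite_Pow_iff finite_subset subsetI)
  have "{xs \<in> tuples r (verts G). distinct xs \<and> set xs \<in> edges G} = (\<Union>e\<in>edges G. permutations_of_set e)"
    using E by (auto simp: tuples_def permutations_of_set_def dest: distinct_card)
  also have "card \<dots> = (\<Sum>e\<in>edges G. card (permutations_of_set e))"
    using finE fin_e by (intro card_UN_disjoint) (auto dest: permutations_of_setD)
  also have "\<dots> = fact r * card (edges G)"
    using E fin_e by simp
  finally show ?thesis .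
qed

lemma verts_complete_partite: "verts (complete_partite r s) = {(i, j). i < r \<and> j < s i}"
  by (auto simp: complete_partite_def Let_def Defs.part_def)

lemma edges_complete_partiteE:
  assumes "e \<in> edges (complete_partite r s)"
  obtains j where "\<And>i. i < r \<Longrightarrow> j i < s i" "e = (\<lambda>i. (i, j i)) ` {..<r}"
proof -
  have eV: "e \<subseteq> (\<Union>i<r. Defs.part s i)" and c1: "\<And>i. i < r \<Longrightarrow> card (e \<inter> Defs.part s i) = 1"
    using assms by (auto simp: complete_partite_def Let_def)
  have "\<exists>j. e \<inter> Defs.part s i = {(i, j)} \<and> j < s i" if "i < r" for i
  proof -
    obtain x where x: "e \<inter> Defs.part s i = {x}" using c1[OF \<open>i < r\<close>] card_1_singletonE by blast
    then have "x \<in> Defs.part s i" by blast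
    then show ?thesis using x by (auto simp: Defs.part_def)
  qed
  then obtain j where j: "\<And>i. i < r \<Longrightarrow> e \<inter> Defs.part s i = {(i, j i)}" "\<And>i. i < r \<Longrightarrow> j i < s i"
    by metis
  have "e = (\<Union>i<r. e \<inter> Defs.part s i)" using eV by blast
  also have "\<dots> = (\<Union>i<r. {(i, j i)})" using j(1) by simp
  also have "\<dots> = (\<lambda>i. (i, j i)) ` {..<r}" by blast
  finally show thesis using that j(2) by blast
qed

text \<open>Vertex (i, j) is sent to entry j of list i, with a list of \<open>t\<close> elements of
  \<open>T\<close> as the last part. An edge is then a choice of one entry from each list, which
  \<open>edge\<close> covers.\<close>

lemma contains_copy_complete_partiteI:
  fixes G :: "'a hypergraph"
  assumes "1 \<le> s" "1 \<le> t" "A \<in> tuples k {a \<in> tuples s (verts G). distinct a}"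
    and "T \<subseteq> verts G" "finite T" "t \<le> card T"
    and edge: "\<And>v. v \<in> T \<Longrightarrow> choice_all (\<lambda>xs. distinct (v # xs) \<and> set (v # xs) \<in> edges G) A"
  shows "contains_copy G (complete_partite (Suc k) (\<lambda>i. if i < k then s else t))"
proof -
  obtain ts where ts: "distinct ts" "set ts \<subseteq> T" "length ts = t"
    by (metis assms(5,6) finite_distinct_list obtain_subset_with_card_n distinct_card finite_subset)
  have lenA: "length A = k" using assms(3) by (simp add: tuples_def)
  have A: "length (A ! i) = s" "set (A ! i) \<subseteq> verts G" "distinct (A ! i)" if "i < k" for i
    using subsetD[OF _ nth_mem, of A _ i] assms(3) that by (auto simp: tuples_def)
  let ?s = "\<lambda>i. if i < k then s else t"
  define B where "B = A @ [ts]"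
  define f where "f = (\<lambda>(i, j). B ! i ! j)"
  have B: "length (B ! i) = ?s i" "set (B ! i) \<subseteq> verts G" "distinct (B ! i)" if "i < Suc k" for i
    using that A ts lenA assms(4) by (auto simp: B_def nth_append less_Suc_eq)
  \<comment> \<open>The neighbour \<open>v\<close> stands first in \<open>edge\<close> but last in
    \<open>B\<close>; neither distinctness nor the underlying set depends on the order.\<close>
  have ch: "distinct (map (\<lambda>i. B ! i ! j i) [0..<Suc k]) \<and> (\<lambda>i. B ! i ! j i) ` {..<Suc k} \<in> edges G"
    if "\<And>i. i < Suc k \<Longrightarrow> j i < ?s i" for j
  proof -
    let ?xs = "map (\<lambda>i. A ! i ! j i) [0..<k]" and ?v = "ts ! j k"
    have "j k < t" using that[of k] by simp
    then have v: "?v \<in> T" using ts nth_mem by blast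
    have "list_all2 (\<lambda>x a. x \<in> set a) ?xs A"
      using lenA A that by (fastforce simp: list_all2_conv_all_nth less_Suc_eq)
    then have *: "distinct (?v # ?xs)" "set (?v # ?xs) \<in> edges G"
      using edge[OF v] by (auto simp: choice_all_def)
    have map_eq: "map (\<lambda>i. B ! i ! j i) [0..<Suc k] = ?xs @ [?v]"
      using lenA by (auto simp: B_def nth_append)
    have image_eq: "(\<lambda>i. B ! i ! j i) ` {..<Suc k} = set (map (\<lambda>i. B ! i ! j i) [0..<Suc k])"
      by (simp add: atLeast0LessThan del: upt_Suc)
    show ?thesis using * unfolding image_eq map_eq by simp
  qed
  have neq: "B ! i ! j \<noteq> B ! i' ! j'"
    if "i < Suc k" "i' < Suc k" "i \<noteq> i'" "j < ?s i" "j' < ?s i'" for i i' j j'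
  proof
    assume eq: "B ! i ! j = B ! i' ! j'"
    \<comment> \<open>Any edge through both vertices shows that they differ. Index 0 is a valid
      default in the other parts because \<open>s\<close> and \<open>t\<close> are at least
      1.\<close>
    define c where "c = (\<lambda>l. if l = i then j else if l = i' then j' else 0)"
    have "distinct (map (\<lambda>l. B ! l ! c l) [0..<Suc k])"
      by (rule ch[THEN conjunct1]) (use that assms(1,2) in \<open>auto simp: c_def\<close>)
    then have "inj_on (\<lambda>l. B ! l ! c l) {0..<Suc k}"
      by (simp add: distinct_map del: upt_Suc)
    from inj_onD[OF this, of i i'] have "i = i'"
      using eq that by (simp add: c_def)
    then show False using that by blast
  qed
  let ?K = "complete_partite (Suc k) ?s"
  have "inj_on f (verts ?K)"
  proof (rule inj_onI)
    fix x y assume xy: "x \<in> verts ?K" "y \<in> verts ?K" "f x = f y"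
    obtain i j i' j' where xy_eq: "x = (i, j)" "y = (i', j')" using surj_pair[of x] surj_pair[of y] by blast
    have b: "i < Suc k" "j < ?s i" "i' < Suc k" "j' < ?s i'" "B ! i ! j = B ! i' ! j'"
      using xy unfolding xy_eq verts_complete_partite f_def by auto
    have "i = i'" using neq[of i i' j j'] b by argo
    moreover have "j = j'"
      using b nth_eq_iff_index_eq[OF B(3)[of i], of j j'] B(1)[of i] unfolding \<open>i = i'\<close> by simp
    ultimately show "x = y" using xy_eq by simp
  qed
  moreover have "f ` verts ?K \<subseteq> verts G"
  proof
    fix x assume "x \<in> f ` verts ?K"
    then obtain i j where ij: "i < Suc k" "j < ?s i" "x = B ! i ! j"
      unfolding verts_complete_partite f_def by auto
    then have "x \<in> set (B ! i)" using B(1)[of i] by simp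
    then show "x \<in> verts G" using B(2)[OF ij(1)] by blast
  qed
  moreover have "f ` e \<in> edges G" if e: "e \<in> edges ?K" for e
  proof -
    obtain j where j: "\<And>i. i < Suc k \<Longrightarrow> j i < ?s i" and e_eq: "e = (\<lambda>i. (i, j i)) ` {..<Suc k}"
      by (rule edges_complete_partiteE[OF e]) blast
    have "f ` e = (\<lambda>i. B ! i ! j i) ` {..<Suc k}"
      unfolding e_eq image_image by (simp add: f_def)
    then show ?thesis using ch[of j] j by argo
  qed
  ultimately show ?thesis unfolding contains_copy_def by blast
qed

section \<open>Numerical estimates\<close>

lemma parameter_estimate:
  fixes \<alpha> n :: real
  assumes k: "2 \<le> k" and n: "1 < n" and \<alpha>: "ln n powr (- 1 / real k) \<le> \<alpha>"
    and \<alpha>_le: "\<alpha> \<le> 1 / real (Suc k) ^ 3"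
    and s: "s = nat \<lfloor>\<alpha> * ln n powr (1 / real k)\<rfloor>"
  shows "1 \<le> s" "real s < n"
    "n powr (1 - \<alpha> ^ (k - 1)) \<le> n * \<alpha> ^ (s ^ k) - k * real s ^ 2"
proof -
  define L where "L = ln n"
  have L0: "L > 0" using n by (simp add: L_def)
  have \<alpha>0: "\<alpha> > 0" using \<alpha> L0 powr_gt_zero[of "ln n" "- 1 / real k"] unfolding L_def by linarith
  let ?u = "L powr (1 / real k)"
  have u0: "?u > 0" using L0 by simp
  have u_pow: "?u ^ k = L" using L0 k by (simp add: powr_power)
  have \<alpha>u: "1 \<le> \<alpha> * ?u"
    using \<alpha> u0 by (simp add: L_def[symmetric] powr_minus field_simps)
  then show s1: "1 \<le> s" unfolding s L_def by linarith
  have s_le: "real s \<le> \<alpha> * ?u" using \<alpha>u unfolding s L_def by linarith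
  have "real s ^ k \<le> (\<alpha> * ?u) ^ k" using s_le by (intro power_mono) auto
  then have sk: "real s ^ k \<le> \<alpha> ^ k * L" by (simp add: power_mult_distrib u_pow)
  have "1 \<le> (\<alpha> * ?u) ^ k" using \<alpha>u by (rule one_le_power)
  then have aL: "1 \<le> \<alpha> ^ k * L" by (simp add: power_mult_distrib u_pow)
  have "real k \<le> real (Suc k) ^ 3"
  proof -
    have "real (Suc k) ^ 1 \<le> real (Suc k) ^ 3" by (rule power_increasing) auto
    then show ?thesis by simp
  qed
  then have "\<alpha> * k \<le> (1 / real (Suc k) ^ 3) * real (Suc k) ^ 3"
    using \<alpha>_le \<alpha>0 by (intro mult_mono) auto
  then have \<alpha>k: "\<alpha> * k \<le> 1" by simp
  have "(3::real) ^ 3 \<le> real (Suc k) ^ 3" using k by (intro power_mono) auto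
  then have "1 / real (Suc k) ^ 3 \<le> 1 / 27" by (intro divide_left_mono) auto
  \<comment> \<open>Since r = k + 1 is at least 3, \<alpha> is at most 1/27.\<close>
  then have \<alpha>27: "\<alpha> \<le> 1 / 27" using \<alpha>_le by linarith
  have \<alpha>k2: "\<alpha> ^ k \<le> \<alpha> ^ 2" using k \<alpha>0 \<alpha>27 by (intro power_decreasing) auto
  have s2: "real s ^ 2 \<le> \<alpha> ^ 2 * L"
  proof -
    have "real s ^ 2 \<le> real s ^ k" using s1 k by (intro power_increasing) auto
    also have "\<dots> \<le> \<alpha> ^ k * L" by (rule sk)
    also have "\<dots> \<le> \<alpha> ^ 2 * L" using \<alpha>k2 L0 by (intro mult_right_mono) auto
    finally show ?thesis .
  qed
  have n_exp: "n = exp L" using n by (simp add: L_def)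
  have L_n: "1 + L \<le> n" unfolding n_exp by (rule exp_ge_add_one_self)
  have "real s \<le> real s ^ 2" using s1 by (simp add: power2_eq_square)
  also have "\<dots> \<le> 1 * L"
    using s2 mult_right_mono[of "\<alpha> ^ 2" 1 L] power_le_one[of \<alpha> 2] \<alpha>0 \<alpha>27 L0 by linarith
  finally show "real s < n" using L_n by simp
  have ks2: "k * real s ^ 2 \<le> L / 27"
  proof -
    have "k * real s ^ 2 \<le> k * (\<alpha> ^ 2 * L)" using s2 by (intro mult_left_mono) auto
    also have "\<dots> = (\<alpha> * k) * (\<alpha> * L)" by (simp add: power2_eq_square)
    also have "\<dots> \<le> 1 * (1 / 27 * L)" using \<alpha>k \<alpha>27 \<alpha>0 L0 by (intro mult_mono) auto
    finally show ?thesis by simp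
  qed
  define y where "y = \<alpha> ^ (k - 1)"
  have y0: "y > 0" using \<alpha>0 by (simp add: y_def)
  have ak: "\<alpha> ^ k = \<alpha> * y" using k by (simp add: y_def power_eq_if)
  have y1: "y \<le> 1" using \<alpha>0 \<alpha>27 by (simp add: y_def power_le_one)
  have yL: "27 \<le> y * L"
  proof -
    have "1 \<le> \<alpha> * (y * L)" using aL ak by (simp add: mult_ac)
    also have "\<dots> \<le> 1 / 27 * (y * L)" using \<alpha>27 y0 L0 by (intro mult_right_mono) auto
    finally show ?thesis by simp
  qed
  have ln_half: "- ln \<alpha> \<le> 1 / (2 * \<alpha>)"
  proof -
    \<comment> \<open>Applying ln x \<le> x - 1 at 1/(2 \<alpha>) rather than 1/\<alpha> gains the
      factor 1/2, which later leaves half of the exponent \<open>y * L\<close> as slack.\<close>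
    have "ln (1 / (2 * \<alpha>)) \<le> 1 / (2 * \<alpha>) - 1" using \<alpha>0 by (intro ln_le_minus_one) auto
    moreover have "ln (1 / (2 * \<alpha>)) = - ln 2 - ln \<alpha>" using \<alpha>0 by (simp add: ln_div ln_mult)
    moreover have "ln (2::real) \<le> 2 - 1" by (rule ln_le_minus_one) simp
    ultimately show ?thesis by linarith
  qed
  have expo: "real (s ^ k) * (- ln \<alpha>) \<le> y * L / 2"
  proof -
    have "real (s ^ k) * (- ln \<alpha>) \<le> (\<alpha> ^ k * L) * (- ln \<alpha>)"
      using sk \<alpha>0 \<alpha>27 by (intro mult_right_mono) auto
    also have "\<dots> \<le> (\<alpha> ^ k * L) * (1 / (2 * \<alpha>))"
      using ln_half aL by (intro mult_left_mono) auto
    also have "\<dots> = y * L / 2" using \<alpha>0 ak by simp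
    finally show ?thesis .
  qed
  \<comment> \<open>\<open>M\<close> is n^(1 - y/2). One half of it will dominate n^(1 - y), the
    other half the loss k s^2.\<close>
  define M where "M = exp (L - y * L / 2)"
  have "\<alpha> ^ (s ^ k) = exp (real (s ^ k) * ln \<alpha>)"
    using \<alpha>0 by (simp add: exp_of_nat_mult del: of_nat_power)
  then have "n * \<alpha> ^ (s ^ k) = exp (L + real (s ^ k) * ln \<alpha>)"
    by (simp add: n_exp exp_add)
  also have "\<dots> \<ge> M" unfolding M_def using expo by simp
  finally have main: "M \<le> n * \<alpha> ^ (s ^ k)" .
  have t_eq: "n powr (1 - y) = exp (- (y * L / 2)) * M"
    using n by (simp add: powr_def L_def M_def exp_add[symmetric] algebra_simps)
  have "exp (- (y * L / 2)) \<le> 1 / 2"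
  proof -
    have "2 \<le> exp (y * L / 2)" using exp_ge_add_one_self[of "y * L / 2"] yL by linarith
    then show ?thesis by (simp add: exp_minus field_simps)
  qed
  then have half: "n powr (1 - y) \<le> M / 2"
    unfolding t_eq using mult_right_mono[of "exp (- (y * L / 2))" "1 / 2" M] by (simp add: M_def)
  \<comment> \<open>As y \<le> 1, \<open>M\<close> is at least exp (L/2), so M/2 is at least 1/2 +
    L/4, which exceeds the bound L/27 on the loss.\<close>
  have "y * L \<le> 1 * L" using y1 L0 by (intro mult_right_mono) auto
  then have "1 + L / 2 \<le> M"
    unfolding M_def using exp_ge_add_one_self[of "L - y * L / 2"] by linarith
  then show "n powr (1 - \<alpha> ^ (k - 1)) \<le> n * \<alpha> ^ (s ^ k) - k * real s ^ 2"
    using ks2 half main L0 unfolding y_def[symmetric] by linarith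
qed

section \<open>Combining the density and numerical bounds\<close>

theorem theorem1:
  fixes r n s t :: nat and \<alpha> :: real and G :: "'a hypergraph"
  assumes "r \<ge> 3" and "n \<ge> 2"
    and "ln (real n) powr (- 1 / (real r - 1)) \<le> \<alpha>"
    and "\<alpha> \<le> 1 / real r ^ 3"
    and "s = nat \<lfloor>\<alpha> * ln (real n) powr (1 / (real r - 1))\<rfloor>"
    and "t = nat \<lceil>real n powr (1 - \<alpha> ^ (r - 2))\<rceil>"
    and "uniform_graph r G"
    and "card (verts G) = n"
    and "real (card (edges G)) \<ge> \<alpha> * real n ^ r / fact r"
  shows "contains_copy G (complete_partite r (\<lambda>i. if i < r - 1 then s else t))"
proof -
  define k where "k = r - 1"
  have r: "r = Suc k" and k: "2 \<le> k" using assms(1) by (auto simp: k_def)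
  have k': "real r - 1 = real k" "r - 2 = k - 1" by (auto simp: r)
  note est = parameter_estimate[OF k, of "real n" \<alpha> s, OF _ assms(3)[unfolded k']
      assms(4)[unfolded r] assms(5)[unfolded k']]
  let ?V = "verts G" and ?P = "\<lambda>xs v. distinct (v # xs) \<and> set (v # xs) \<in> edges G"
  have n: "1 < real n" using assms(2) by simp
  have V: "finite ?V" "?V \<noteq> {}" using assms(2,7,8) by (auto simp: uniform_graph_def)
  have \<alpha>0: "0 \<le> \<alpha>" using assms(3) by (meson order_trans powr_ge_zero)
  have "\<alpha> * real n ^ Suc k \<le> real (fact r * card (edges G))"
    using assms(9) by (simp add: pos_divide_le_eq r del: fact_Suc power_Suc) (simp only: mult.commute)
  also have "\<dots> = (\<Sum>xs\<in>tuples (Suc k) ?V. of_bool (distinct xs \<and> set xs \<in> edges G))"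
    using V card_ordered_edges[OF assms(7)]
    by (simp only: r real_card_filter_eq_sum[symmetric] finite_tuples)
  \<comment> \<open>The first entry of an ordered edge is singled out as the vertex for the part of
    size \<open>t\<close>; the other \<open>k\<close> entries are blown up.\<close>
  also have "\<dots> = (\<Sum>v\<in>?V. \<Sum>xs\<in>tuples k ?V. of_bool (?P xs v))"
    by (simp only: sum_tuples_Suc)
  finally have dens: "\<alpha> * real (card ?V) ^ Suc k \<le> (\<Sum>v\<in>?V. \<Sum>xs\<in>tuples k ?V. of_bool (?P xs v))"
    by (simp only: assms(8))
  have t: "real n powr (1 - \<alpha> ^ (k - 1)) \<le> card ?V * \<alpha> ^ (s ^ k) - k * real s ^ 2"
    using est(3)[OF n] by (simp only: assms(8))
  have "0 < real n powr (1 - \<alpha> ^ (k - 1))" using n by simp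
  then have pos: "k * real s ^ 2 < card ?V * \<alpha> ^ (s ^ k)" using t by linarith
  have s: "s < card ?V" using est(2)[OF n] assms(8) by simp
  obtain A where A: "A \<in> tuples k {a \<in> tuples s ?V. distinct a}"
    and rich: "card ?V * \<alpha> ^ (s ^ k) - k * real s ^ 2 \<le> card {v \<in> ?V. choice_all (\<lambda>xs. ?P xs v) A}"
    using exists_rich_distinct_tuples[OF V \<alpha>0 s pos dens] by blast
  \<comment> \<open>An integer at least n^(1 - \<alpha>^(k-1)) is also at least its ceiling, so
    rounding up to \<open>t\<close> costs nothing.\<close>
  have "t \<le> card {v \<in> ?V. choice_all (\<lambda>xs. ?P xs v) A}"
    using t rich unfolding assms(6) k' by linarith
  moreover have "1 \<le> t"
    using \<open>0 < real n powr (1 - \<alpha> ^ (k - 1))\<close> unfolding assms(6) k' by linarith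
  ultimately have "contains_copy G (complete_partite (Suc k) (\<lambda>i. if i < k then s else t))"
    using V est(1)[OF n] A by (intro contains_copy_complete_partiteI) auto
  then show ?thesis by (simp add: r)
qed

end
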